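(* Let $d\ge 1$ be odd and let $G=(V,E)$ be a finite simple graph which is a geometric graph of dimension $d$. Then the curvature satisfies $K(x)=0$ for every vertex $x\in V$, and the Euler characteristic satisfies $\chi(G)=0$.
   Context: For a finite simple graph $H$, let $v_k(H)$ be the number of complete subgraphs $K_{k+1}$ of $H$; the Euler characteristic is $\chi(H)=\sum_{k\ge 0}(-1)^k v_k(H)$ (so $\chi(\emptyset)=0$). For a vertex $x$, the unit sphere $S(x)$ is the subgraph induced by the neighbors of $x$. Curvature: let $V_k(x)$ be the number of complete subgraphs $K_{k+1}$ of $S(x)$ for $k\ge0$, and $V_{-1}(x)=1$. Then $K(x)=\sum_{k=0}^{\infty}(-1)^k\frac{V_{k-1}(x)}{k+1}$. Dimension (inductive): $\dim(\emptyset)=-1$; for a vertex $x$ of a nonempty graph $\dim(x)=1+\dim(S(x))$; and $\dim(H)$ is the average of $\dim(x)$ over the vertices $x$ of $H$. Geometric graphs (inductive): a graph is a geometric graph of dimension $1$ if $\dim(x)=1$ and $\chi(S(x))=2$ for every vertex $x$. For $d\ge2$, a graph is a geometric graph of dimension $d$ if $\dim(x)=d$ for every vertex $x$ and each unit sphere $S(x)$ is a geometric graph of dimension $d-1$ satisfying $\chi(S(x))=1-(-1)^d$. *)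

theory Defs
  imports Complex_Main
begin

type_synonym 'a graph = "'a set \<times> 'a set set"

abbreviation verts :: "'a graph \<Rightarrow> 'a set" where
  "verts G \<equiv> fst G"

abbreviation edges :: "'a graph \<Rightarrow> 'a set set" where
  "edges G \<equiv> snd G"

definition finite_simple_graph :: "'a graph \<Rightarrow> bool" where
  "finite_simple_graph G \<longleftrightarrow>
     finite (verts G) \<and> (\<forall>e\<in>edges G. e \<subseteq> verts G \<and> card e = 2)"

definition induced_subgraph :: "'a graph \<Rightarrow> 'a set \<Rightarrow> 'a graph" where
  "induced_subgraph G W = (W, {e \<in> edges G. e \<subseteq> W})"

text \<open>The conditions \<open>y \<in> verts G\<close> and \<open>y \<noteq> x\<close> are automatic in a simple graph; they make the
  unit sphere smaller than \<open>G\<close> for arbitrary pairs, so that the recursion for the dimension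
  terminates.\<close>

definition neighbors :: "'a graph \<Rightarrow> 'a \<Rightarrow> 'a set" where
  "neighbors G x = {y \<in> verts G. y \<noteq> x \<and> {x, y} \<in> edges G}"

definition unit_sphere :: "'a graph \<Rightarrow> 'a \<Rightarrow> 'a graph" where
  "unit_sphere G x = induced_subgraph G (neighbors G x)"

text \<open>A complete subgraph \<open>K\<^sub>k\<^sub>+\<^sub>1\<close> is identified with its set of \<open>k + 1\<close> pairwise adjacent vertices.\<close>

definition num_complete :: "nat \<Rightarrow> 'a graph \<Rightarrow> nat" where
  "num_complete k G =
     card {W. W \<subseteq> verts G \<and> card W = k + 1 \<and> (\<forall>x\<in>W. \<forall>y\<in>W. x \<noteq> y \<longrightarrow> {x, y} \<in> edges G)}"

definition euler_char :: "'a graph \<Rightarrow> int" where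
  "euler_char G = (\<Sum>k. (-1) ^ k * int (num_complete k G))"

text \<open>The index is shifted by one: \<open>sphere_num G x k\<close> is \<open>V\<^sub>k\<^sub>-\<^sub>1(x)\<close>, with \<open>V\<^sub>-\<^sub>1(x) = 1\<close>.\<close>

definition sphere_num :: "'a graph \<Rightarrow> 'a \<Rightarrow> nat \<Rightarrow> nat" where
  "sphere_num G x k = (case k of 0 \<Rightarrow> 1 | Suc j \<Rightarrow> num_complete j (unit_sphere G x))"

definition curvature :: "'a graph \<Rightarrow> 'a \<Rightarrow> real" where
  "curvature G x = (\<Sum>k. (-1) ^ k * real (sphere_num G x k) / (real k + 1))"

text \<open>On infinite vertex sets the value \<open>-1\<close> is a dummy.\<close>

function graph_dim :: "'a graph \<Rightarrow> real" where
  "graph_dim G =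
     (if finite (verts G) \<and> verts G \<noteq> {}
      then (\<Sum>x\<in>verts G. 1 + graph_dim (unit_sphere G x)) / real (card (verts G))
      else -1)"
  by pat_completeness auto
termination
proof (relation "measure (\<lambda>G. card (verts G))")
  fix G :: "'a graph" and x
  assume "finite (verts G) \<and> verts G \<noteq> {}" and "x \<in> verts G"
  moreover from this have "neighbors G x \<subset> verts G"
    by (auto simp: neighbors_def)
  ultimately show "(unit_sphere G x, G) \<in> measure (\<lambda>G. card (verts G))"
    by (simp add: unit_sphere_def induced_subgraph_def psubset_card_mono)
qed auto

declare graph_dim.simps [simp del]

definition vertex_dim :: "'a graph \<Rightarrow> 'a \<Rightarrow> real" where
  "vertex_dim G x = 1 + graph_dim (unit_sphere G x)"

lemma graph_dim_empty: "verts G = {} \<Longrightarrow> graph_dim G = -1"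
  by (simp add: graph_dim.simps)

lemma graph_dim_average:
  "finite (verts G) \<Longrightarrow> verts G \<noteq> {} \<Longrightarrow>
     graph_dim G = (\<Sum>x\<in>verts G. vertex_dim G x) / real (card (verts G))"
  by (subst graph_dim.simps) (simp add: vertex_dim_def)

inductive geometric_graph :: "nat \<Rightarrow> 'a graph \<Rightarrow> bool" where
  dim_one:
    "(\<And>x. x \<in> verts G \<Longrightarrow> vertex_dim G x = 1 \<and> euler_char (unit_sphere G x) = 2)
      \<Longrightarrow> geometric_graph 1 G"
| dim_ge_two:
    "d \<ge> 2 \<Longrightarrow>
     (\<And>x. x \<in> verts G \<Longrightarrow>
        vertex_dim G x = real d \<and>
        geometric_graph (d - 1) (unit_sphere G x) \<and>
        euler_char (unit_sphere G x) = 1 - (-1) ^ d)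
      \<Longrightarrow> geometric_graph d G"

end

(* The generating function f_G(t), the sum of t^|W| over all cliques W of G including the empty one,
   satisfies f_G(-1) = 1 - chi(G), and its derivative is the sum of f_{S(x)} over the vertices x.
   The curvature K(x) is the integral of f_{S(x)} over [-1,0].  Induction on the dimension gives
   the Dehn-Sommerville symmetry f_{S(x)}(-1-t) = (-1)^d f_{S(x)}(t) in a geometric graph of
   dimension d: the symmetry one dimension lower is that of the derivative of f_{S(x)}, and the
   constant of integration is fixed by the Euler characteristic of S(x).  For odd d the functions f_{S(x)} are therefore
   antisymmetric about -1/2, so that their integrals over [-1,0], and that of f_G', vanish. *)

theory Submission
  imports Defs
begin

definition cliques :: "'a graph \<Rightarrow> 'a set set" where
  "cliques G = {W. W \<subseteq> verts G \<and> (\<forall>x\<in>W. \<forall>y\<in>W. x \<noteq> y \<longrightarrow> {x, y} \<in> edges G)}"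

definition clique_gf :: "'a graph \<Rightarrow> real \<Rightarrow> real" where
  "clique_gf G t = (\<Sum>W\<in>cliques G. t ^ card W)"

lemma finite_cliques: "finite (verts G) \<Longrightarrow> finite (cliques G)"
  by (rule finite_subset[of _ "Pow (verts G)"]) (auto simp: cliques_def)

lemma finite_clique: "finite (verts G) \<Longrightarrow> W \<in> cliques G \<Longrightarrow> finite W"
  by (auto simp: cliques_def intro: finite_subset)

lemma empty_in_cliques: "{} \<in> cliques G"
  by (simp add: cliques_def)

lemma verts_unit_sphere: "verts (unit_sphere G x) = neighbors G x"
  by (simp add: unit_sphere_def induced_subgraph_def)

lemma neighbors_subset: "neighbors G x \<subseteq> verts G"
  by (auto simp: neighbors_def)

lemma finite_verts_unit_sphere: "finite (verts G) \<Longrightarrow> finite (verts (unit_sphere G x))"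
  by (simp add: verts_unit_sphere finite_subset[OF neighbors_subset])

lemma bij_betw_cliques_unit_sphere:
  assumes "x \<in> verts G"
  shows "bij_betw (insert x) (cliques (unit_sphere G x)) {W \<in> cliques G. x \<in> W}"
proof (rule bij_betw_byWitness[where f' = "\<lambda>W. W - {x}"])
  show "insert x ` cliques (unit_sphere G x) \<subseteq> {W \<in> cliques G. x \<in> W}"
    using assms by (auto simp: cliques_def unit_sphere_def induced_subgraph_def
        neighbors_def insert_commute[of _ x])
  show "(\<lambda>W. W - {x}) ` {W \<in> cliques G. x \<in> W} \<subseteq> cliques (unit_sphere G x)"
    by (auto simp: cliques_def unit_sphere_def induced_subgraph_def neighbors_def)
qed (auto simp: cliques_def unit_sphere_def induced_subgraph_def neighbors_def)

lemma clique_gf_0: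
  fixes G :: "'a graph"
  assumes "finite (verts G)"
  shows "clique_gf G 0 = 1"
proof -
  \<comment> \<open>Only the empty clique survives, through \<open>0 ^ 0 = 1\<close>. Finiteness of
    the other cliques keeps their \<open>card\<close> from defaulting to 0.\<close>
  have "clique_gf G 0 = (\<Sum>W\<in>{{} :: 'a set}. 0 ^ card W)"
    unfolding clique_gf_def
    by (rule sum.mono_neutral_right)
      (use assms in \<open>auto simp: finite_cliques empty_in_cliques finite_clique card_eq_0_iff\<close>)
  then show ?thesis by simp
qed

lemma clique_gf_empty:
  assumes "verts G = {}"
  shows "clique_gf G t = 1"
proof -
  have "cliques G = {{}}" using assms by (auto simp: cliques_def)
  then show ?thesis by (simp add: clique_gf_def)
qed

text \<open>Double counting of pairs of a clique \<open>W\<close> and a vertex \<open>x\<close> in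
  it: the factor \<open>card W\<close> produced by differentiation counts the choices of
  \<open>x\<close>, and removing \<open>x\<close> leaves a clique of its unit sphere with one vertex
  less.\<close>

lemma clique_gf_deriv:
  assumes fin: "finite (verts G)"
  shows "(clique_gf G has_real_derivative (\<Sum>x\<in>verts G. clique_gf (unit_sphere G x) t)) (at t)"
proof -
  have "(clique_gf G has_real_derivative
      (\<Sum>W\<in>cliques G. real (card W) * t ^ (card W - 1))) (at t)"
    unfolding clique_gf_def[abs_def]
    by (auto intro!: derivative_eq_intros sum.cong)
  also have "(\<Sum>W\<in>cliques G. real (card W) * t ^ (card W - 1))
      = (\<Sum>W\<in>cliques G. \<Sum>x | x \<in> verts G \<and> x \<in> W. t ^ (card W - 1))"
  proof (rule sum.cong[OF refl])
    fix W assume "W \<in> cliques G"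
    then have "{x. x \<in> verts G \<and> x \<in> W} = W" by (auto simp: cliques_def)
    then show "real (card W) * t ^ (card W - 1) = (\<Sum>x | x \<in> verts G \<and> x \<in> W. t ^ (card W - 1))"
      by simp
  qed
  also have "\<dots> = (\<Sum>x\<in>verts G. \<Sum>W | W \<in> cliques G \<and> x \<in> W. t ^ (card W - 1))"
    by (rule sum.swap_restrict) (use fin in \<open>auto simp: finite_cliques\<close>)
  also have "\<dots> = (\<Sum>x\<in>verts G. clique_gf (unit_sphere G x) t)"
  proof (rule sum.cong[OF refl])
    fix x assume x: "x \<in> verts G"
    have "(\<Sum>W | W \<in> cliques G \<and> x \<in> W. t ^ (card W - 1))
        = (\<Sum>U\<in>cliques (unit_sphere G x). t ^ (card (insert x U) - 1))"
      using sum.reindex_bij_betw[OF bij_betw_cliques_unit_sphere[OF x],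
          of "\<lambda>W. t ^ (card W - 1)"] by simp
    also have "\<dots> = clique_gf (unit_sphere G x) t"
      unfolding clique_gf_def
    proof (rule sum.cong[OF refl])
      fix U assume U: "U \<in> cliques (unit_sphere G x)"
      then have "x \<notin> U" by (auto simp: cliques_def verts_unit_sphere neighbors_def)
      moreover have "finite U" using U fin finite_clique finite_verts_unit_sphere by metis
      ultimately show "t ^ (card (insert x U) - 1) = t ^ card U" by simp
    qed
    finally show "(\<Sum>W | W \<in> cliques G \<and> x \<in> W. t ^ (card W - 1))
        = clique_gf (unit_sphere G x) t" .
  qed
  finally show ?thesis .
qed

text \<open>Turns the series defining Euler characteristic and curvature into finite sums over
  cliques, since all but finitely many fibres of \<open>g\<close> are empty. The type class covers
  both the \<open>int\<close> and the \<open>real\<close> series.\<close>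

lemma suminf_card_fibre:
  fixes c :: "nat \<Rightarrow> 'b :: {comm_ring_1, t2_space}"
  assumes fin: "finite C"
  shows "(\<Sum>k. c k * of_nat (card {W \<in> C. g W = k})) = (\<Sum>W\<in>C. c (g W))"
proof -
  have "(\<Sum>k. c k * of_nat (card {W \<in> C. g W = k}))
      = (\<Sum>k\<in>g ` C. c k * of_nat (card {W \<in> C. g W = k}))"
  proof (rule suminf_finite)
    fix k assume "k \<notin> g ` C"
    then have "{W \<in> C. g W = k} = {}" by auto
    then show "c k * of_nat (card {W \<in> C. g W = k}) = 0" by (simp only: card.empty) simp
  qed (use fin in simp)
  also have "\<dots> = (\<Sum>k\<in>g ` C. \<Sum>W\<in>{W \<in> C. g W = k}. c (g W))"
    by (rule sum.cong) (auto simp: mult.commute)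
  also have "\<dots> = (\<Sum>W\<in>C. c (g W))"
    by (rule sum.group) (use fin in auto)
  finally show ?thesis .
qed

lemma num_complete_cliques: "num_complete k G = card {W \<in> cliques G. card W = k + 1}"
  unfolding num_complete_def cliques_def by (rule arg_cong[of _ _ card]) auto

lemma sphere_num_cliques:
  assumes "finite (verts G)"
  shows "sphere_num G x k = card {W \<in> cliques (unit_sphere G x). card W = k}"
proof (cases k)
  case 0
  have "{W \<in> cliques (unit_sphere G x). card W = 0} = {{}}"
    using finite_clique[OF finite_verts_unit_sphere[OF assms]] empty_in_cliques by fastforce
  then show ?thesis by (simp add: 0 sphere_num_def)
qed (simp add: sphere_num_def num_complete_cliques)

lemma euler_char_clique_gf:
  assumes fin: "finite (verts G)"
  shows "real_of_int (euler_char G) = 1 - clique_gf G (-1)"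
proof -
  \<comment> \<open>The empty clique must go: truncated subtraction gives
    \<open>card {} - 1 = 0\<close>, which would count it among the vertices.\<close>
  define C where "C = cliques G - {{}}"
  have finC: "finite C" using fin by (simp add: C_def finite_cliques)
  have card_pos: "card W > 0" if "W \<in> C" for W
    using that finite_clique[OF fin] by (auto simp: C_def card_gt_0_iff)
  have "{W \<in> cliques G. card W = k + 1} = {W \<in> C. card W - 1 = k}" for k
    using card_pos by (fastforce simp: C_def)
  then have "euler_char G = (\<Sum>k. (-1) ^ k * of_nat (card {W \<in> C. card W - 1 = k}))"
    by (simp add: euler_char_def num_complete_cliques)
  also have "\<dots> = (\<Sum>W\<in>C. (-1) ^ (card W - 1))"
    by (rule suminf_card_fibre[OF finC])
  also have "real_of_int \<dots> = (\<Sum>W\<in>C. - ((-1) ^ card W))"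
    unfolding of_int_sum
  proof (rule sum.cong[OF refl])
    fix W assume "W \<in> C"
    then obtain n where "card W = Suc n" using card_pos gr0_implies_Suc by blast
    then show "real_of_int ((-1) ^ (card W - 1)) = - ((-1) ^ card W)" by simp
  qed
  finally show ?thesis
    by (simp add: clique_gf_def C_def sum_negf sum_diff1 finite_cliques[OF fin] empty_in_cliques)
qed

text \<open>The shifted index \<open>k\<close> is the clique size, and the empty clique accounts for
  the leading term 1. Each summand is the integral of \<open>t ^ card W\<close> over [-1,0].\<close>

lemma curvature_cliques:
  assumes fin: "finite (verts G)"
  shows "curvature G x = (\<Sum>W\<in>cliques (unit_sphere G x). (-1) ^ card W / (real (card W) + 1))"
proof -
  have "curvature G x = (\<Sum>k. ((-1) ^ k / (real k + 1)) *
      of_nat (card {W \<in> cliques (unit_sphere G x). card W = k}))"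
    by (simp add: curvature_def sphere_num_cliques[OF fin])
  also have "\<dots> = (\<Sum>W\<in>cliques (unit_sphere G x). (-1) ^ card W / (real (card W) + 1))"
    by (rule suminf_card_fibre) (simp add: fin finite_cliques finite_verts_unit_sphere)
  finally show ?thesis .
qed

text \<open>Says without integrals that \<open>q\<close> integrates to 0 over [-1,0]. The function
  \<open>p t - p (-1 - t)\<close> has derivative \<open>q t + q (-1 - t) = 0\<close>, so it is
  constant; its values at 0 and -1 are negatives of each other, hence both vanish.\<close>

lemma antisymmetric_deriv_imp_eq:
  fixes p q :: "real \<Rightarrow> real"
  assumes deriv: "\<And>t. (p has_real_derivative q t) (at t)"
    and anti: "\<And>t. q (-1 - t) = - q t"
  shows "p (-1) = p 0"
proof -
  have "((\<lambda>t. p t - p (-1 - t)) has_real_derivative 0) (at t)" for t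
    by (auto intro!: derivative_eq_intros DERIV_chain2[OF deriv] deriv simp: anti)
  then have "p 0 - p (-1 - 0) = p (-1) - p (-1 - (-1))"
    using DERIV_isconst_all[of "\<lambda>t. p t - p (-1 - t)" 0 "-1"] by blast
  then show ?thesis by simp
qed

text \<open>Inductive step of the symmetry, with \<open>s\<close> the sign for the unit spheres.
  Reflection contributes a minus sign to the derivative, so \<open>?h\<close> is constant; its value
  at 0 is \<open>clique_gf G (-1) + s\<close>, which the Euler characteristic makes 0.\<close>

lemma clique_gf_symmetric:
  assumes fin: "finite (verts G)"
    and sphere: "\<And>x t. x \<in> verts G \<Longrightarrow>
        clique_gf (unit_sphere G x) (-1 - t) = s * clique_gf (unit_sphere G x) t"
    and euler: "real_of_int (euler_char G) = 1 + s"
  shows "clique_gf G (-1 - t) = - s * clique_gf G t"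
proof -
  let ?h = "\<lambda>t. clique_gf G (-1 - t) + s * clique_gf G t"
  have "(?h has_real_derivative 0) (at t)" for t
    by (auto intro!: derivative_eq_intros DERIV_chain2[OF clique_gf_deriv[OF fin]]
        clique_gf_deriv[OF fin] simp: sum_distrib_right sphere mult.commute[of s])
  then have "?h t = ?h 0"
    using DERIV_isconst_all[of ?h t 0] by blast
  also have "\<dots> = 0"
    using euler euler_char_clique_gf[OF fin] clique_gf_0[OF fin] by simp
  finally show ?thesis by simp
qed

lemma graph_dim_nonneg:
  assumes "finite (verts G)" "verts G \<noteq> {}"
  shows "graph_dim G \<ge> 0"
  using assms
proof (induction G rule: graph_dim.induct)
  case (1 G)
  have "vertex_dim G x \<ge> 0" if "x \<in> verts G" for x
    using 1 that finite_verts_unit_sphere[of G x] graph_dim_empty[of "unit_sphere G x"]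
    by (cases "verts (unit_sphere G x) = {}") (auto simp: vertex_dim_def)
  then show ?case
    using "1.prems" by (simp add: graph_dim_average sum_nonneg)
qed

lemma graph_dim_ge: "finite (verts G) \<Longrightarrow> graph_dim G \<ge> -1"
  using graph_dim_nonneg[of G] graph_dim_empty[of G] by fastforce

text \<open>Needed for the base case of the induction. An average of nonnegative vertex dimensions
  is 0 only if all of them are, so every unit sphere has dimension -1, which a finite nonempty graph
  cannot have.\<close>

lemma graph_dim_0_imp_neighbors_empty:
  assumes fin: "finite (verts G)" and dim: "graph_dim G = 0" and x: "x \<in> verts G"
  shows "neighbors G x = {}"
proof -
  have nonneg: "vertex_dim G y \<ge> 0" for y
    using graph_dim_ge[OF finite_verts_unit_sphere[OF fin, of y]] by (simp add: vertex_dim_def)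
  have "(\<Sum>y\<in>verts G. vertex_dim G y) = 0"
    using dim x fin graph_dim_average[OF fin] by auto
  then have "vertex_dim G x = 0"
    using sum_nonneg_eq_0_iff[OF fin, of "vertex_dim G"] nonneg x by blast
  then have "graph_dim (unit_sphere G x) = -1" by (simp add: vertex_dim_def)
  then show ?thesis
    using graph_dim_nonneg[OF finite_verts_unit_sphere[OF fin, of x]]
    by (auto simp: verts_unit_sphere)
qed

theorem clique_gf_sphere_dehn_sommerville:
  assumes "geometric_graph d G" and "finite (verts G)" and "x \<in> verts G"
  shows "clique_gf (unit_sphere G x) (-1 - t) = (-1) ^ d * clique_gf (unit_sphere G x) t"
  using assms
proof (induction arbitrary: x t rule: geometric_graph.induct)
  case (dim_one G)
  let ?S = "unit_sphere G x"
  have fin: "finite (verts ?S)" by (rule finite_verts_unit_sphere[OF dim_one.prems(1)])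
  have dim: "graph_dim ?S = 0" and euler: "euler_char ?S = 2"
    using dim_one.hyps[OF dim_one.prems(2)] by (simp_all add: vertex_dim_def)
  \<comment> \<open>Here \<open>s = 1\<close>: the unit spheres inside \<open>?S\<close> are empty,
    with constant generating function 1, and the Euler characteristic is
    \<open>2 = 1 + s\<close>.\<close>
  have "clique_gf ?S (-1 - t) = - 1 * clique_gf ?S t"
  proof (rule clique_gf_symmetric[OF fin])
    fix y u assume "y \<in> verts ?S"
    then have "verts (unit_sphere ?S y) = {}"
      using graph_dim_0_imp_neighbors_empty[OF fin dim] by (simp add: verts_unit_sphere)
    then show "clique_gf (unit_sphere ?S y) (-1 - u) = 1 * clique_gf (unit_sphere ?S y) u"
      by (simp add: clique_gf_empty)
  qed (simp add: euler)
  then show ?case by simp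
next
  case (dim_ge_two d G)
  let ?S = "unit_sphere G x"
  have fin: "finite (verts ?S)" by (rule finite_verts_unit_sphere[OF dim_ge_two.prems(1)])
  note IH = dim_ge_two.IH[OF dim_ge_two.prems(2)]
  \<comment> \<open>Matches the prescribed Euler characteristic \<open>1 - (-1) ^ d\<close> with
    \<open>1 + s\<close> for \<open>s = (-1) ^ (d - 1)\<close>.\<close>
  have sign: "(-1) ^ d = - ((-1) ^ (d - 1) :: real)"
    using dim_ge_two.hyps by (cases d) auto
  have "clique_gf ?S (-1 - t) = - ((-1) ^ (d - 1)) * clique_gf ?S t"
  proof (rule clique_gf_symmetric[OF fin])
    show "clique_gf (unit_sphere ?S y) (-1 - u) = (-1) ^ (d - 1) * clique_gf (unit_sphere ?S y) u"
      if "y \<in> verts ?S" for y u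
      using IH fin that by blast
    show "real_of_int (euler_char ?S) = 1 + (-1) ^ (d - 1)"
      using IH by (simp add: sign)
  qed
  then show ?case by (simp add: sign)
qed

theorem corollary2:
  fixes G :: "'a graph" and d :: nat
  assumes "finite_simple_graph G"
    and "d \<ge> 1" and "odd d"
    and "geometric_graph d G"
  shows "(\<forall>x\<in>verts G. curvature G x = 0) \<and> euler_char G = 0"
proof
  have fin: "finite (verts G)" using assms(1) by (simp add: finite_simple_graph_def)
  have anti: "clique_gf (unit_sphere G x) (-1 - t) = - clique_gf (unit_sphere G x) t"
    if "x \<in> verts G" for x t
    using clique_gf_sphere_dehn_sommerville[OF assms(4) fin that] assms(3) by simp
  show "\<forall>x\<in>verts G. curvature G x = 0"
  proof
    fix x assume x: "x \<in> verts G"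
    let ?C = "cliques (unit_sphere G x)"
    \<comment> \<open>The antiderivative of the generating function of the unit sphere that vanishes
      at 0; its value at -1 is minus the curvature.\<close>
    let ?F = "\<lambda>t::real. \<Sum>W\<in>?C. t ^ Suc (card W) / (real (card W) + 1)"
    have "?F (-1) = ?F 0"
    proof (rule antisymmetric_deriv_imp_eq)
      show "(?F has_real_derivative clique_gf (unit_sphere G x) t) (at t)" for t
        unfolding clique_gf_def
      proof (rule DERIV_sum)
        fix W
        show "((\<lambda>t. t ^ Suc (card W) / (real (card W) + 1)) has_real_derivative t ^ card W) (at t)"
          using DERIV_cdivide[OF DERIV_pow[of "Suc (card W)" t], of "real (card W) + 1"]
          by (simp add: add.commute)
      qed
    qed (rule anti[OF x])
    then show "curvature G x = 0"
      by (simp add: curvature_cliques[OF fin] sum_negf)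
  qed
  \<comment> \<open>\<open>clique_gf G\<close> is itself an antiderivative of a sum of antisymmetric
    functions.\<close>
  have "clique_gf G (-1) = clique_gf G 0"
    by (rule antisymmetric_deriv_imp_eq[OF clique_gf_deriv[OF fin]]) (simp add: anti sum_negf)
  then show "euler_char G = 0"
    using euler_char_clique_gf[OF fin] clique_gf_0[OF fin] by simp
qed

end
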